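(* Let $\lambda$ be a nonzero real number and let $Y$ be the normal random variable with parameters $(\mu,\sigma^2)$, where $\mu\ne0$ and $\sigma>0$, i.e. with density $f(x)=\frac{1}{\sqrt{2\pi}\,\sigma}e^{-\frac{(x-\mu)^2}{2\sigma^2}}$, $-\infty<x<\infty$. Then, for all integers $n\ge k\ge 0$, $$S_{2}^{Y}(n,k)=\sum_{j=k}^{n}\frac{n!}{j!}\binom{j}{n-j} \mu^{2j-n} \Big(\frac{\sigma^{2}}{2} \Big)^{n-j} S_{2}(j,k),$$ $$S_{1}^{Y}(n,k)=\frac{1}{k!}\Big(-\frac{\mu}{\sigma^{2}}\Big)^{k}\sum_{j=0}^{k}\sum_{l=0}^{n}(-1)^{j}\binom{k}{j}\Big(\frac{j}{2}\Big)_{l}2^{l}\Big(\frac{\sigma}{\mu}\Big)^{2l}S_{1}(n,l),$$ $$S_{2,\lambda}^{Y}(n,k)=\sum_{m=k}^{n}\sum_{j=k}^{m}\frac{m!}{j!}\binom{j}{m-j}\mu^{2j-m}\Big(\frac{\sigma^{2}}{2}\Big)^{m-j}\lambda^{n-m}S_{2}(j,k)S_{1}(n,m),$$ $$S_{1,\lambda}^{Y}(n,k)=\frac{1}{\lambda^{k}}\sum_{m=0}^{n}\sum_{j=k}^{\infty}\sum_{l=0}^{j}(-1)^{j+l}\frac{1}{j!}\Big(\frac{\lambda \mu}{\sigma^{2}} \Big )^{j}\Big(\frac{l}{2}\Big)_{m}2^{m}\Big(\frac{\sigma}{\mu} \Big)^{2m}\binom{j}{l}S_{2}(j,k) S_{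1}(n,m).$$
   Context: Classical notions. $(x)_0=1$, $(x)_n=x(x-1)\cdots(x-n+1)$ for $n\ge1$. $\binom{a}{b}=0$ for integers $b>a\ge 0$. $S_2(n,k)$ and $S_1(n,k)$ are the Stirling numbers of the second kind and the (signed) Stirling numbers of the first kind: $\frac{1}{k!}(e^t-1)^k=\sum_{n\ge k}S_2(n,k)\frac{t^n}{n!}$, $\frac{1}{k!}(\log(1+t))^k=\sum_{n\ge k}S_1(n,k)\frac{t^n}{n!}$. For nonzero real $\lambda$: $(x)_{0,\lambda}=1$, $(x)_{n,\lambda}=x(x-\lambda)\cdots(x-(n-1)\lambda)$; $e_\lambda^x(t)=(1+\lambda t)^{x/\lambda}=\sum_{n\ge0}(x)_{n,\lambda}\frac{t^n}{n!}$. Multiple sums are iterated sums in the order written (rightmost sum innermost). Probabilistic versions. For a random variable $Y$ whose moment generating function exists near $0$ and with $E[Y]\ne0$, put $e_Y(t)=E[e^{Yt}]-1=\sum_{n\ge1}E[Y^n]\frac{t^n}{n!}$ and $e_{Y,\lambda}(t)=E[e_\lambda^Y(t)]-1=\sum_{n\ge1}E[(Y)_{n,\lambda}]\frac{t^n}{n!}$ (power series in $t$), and let $\bar e_Y(t)$, $\bar e_{Y,\lambda}(t)$ be their compositional inverses. Then for $k\ge0$: $\frac{1}{k!}(e_Y(t))^k=\sum_{n\ge k}S_2^Y(n,k)\frac{t^n}{n!}$, $\frac{1}{k!}(\bar e_Y(t))^k=\sum_{n\ge k}S_1^Y(n,k)\frac{t^n}{n!}$, $\frac{1}{k!}(e_{Y,\lambda}(t))^k=\sum_{n\ge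 k}S_{2,\lambda}^Y(n,k)\frac{t^n}{n!}$, $\frac{1}{k!}(\bar e_{Y,\lambda}(t))^k=\sum_{n\ge k}S_{1,\lambda}^Y(n,k)\frac{t^n}{n!}$ define the probabilistic (degenerate) Stirling numbers associated with $Y$. *)

theory Defs
  imports
    "HOL-Probability.Probability"
    "HOL-Computational_Algebra.Formal_Power_Series"
    "HOL-Combinatorics.Stirling"
begin

unbundle no vec_syntax
unbundle fps_syntax

definition falling :: "real \<Rightarrow> nat \<Rightarrow> real" where
  "falling x n = (\<Prod>i<n. x - real i)"

definition deg_falling :: "real \<Rightarrow> real \<Rightarrow> nat \<Rightarrow> real" where
  "deg_falling lam x n = (\<Prod>i<n. x - real i * lam)"

text \<open>The power series of \<open>(1 + lam * t) powr (x / lam)\<close> in \<open>t\<close>;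
  see \<open>deg_exp_sums\<close> below.\<close>
definition deg_exp :: "real \<Rightarrow> real \<Rightarrow> real fps" where
  "deg_exp lam x = Abs_fps (\<lambda>n. deg_falling lam x n / fact n)"

text \<open>If \<open>F\<close> is the exponential generating function of a sequence \<open>a\<close>, then
  \<open>egf_nth F n\<close> is \<open>a n\<close>.\<close>
definition egf_nth :: "real fps \<Rightarrow> nat \<Rightarrow> real" where
  "egf_nth F n = fact n * F $ n"

lemma egf_nth_iff: "(\<forall>n. egf_nth F n = a n) \<longleftrightarrow> F = Abs_fps (\<lambda>n. a n / fact n)"
  by (auto simp: egf_nth_def fps_eq_iff field_simps)

text \<open>Signed Stirling numbers of the first kind, by their generating function. In the library,
  \<open>Stirling\<close> is of the second kind, and \<open>stirling\<close> is of the first kind but unsigned. That these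
  recursive definitions agree with the generating functions is proved below.\<close>
definition S1 :: "nat \<Rightarrow> nat \<Rightarrow> real" where
  "S1 n k = egf_nth (fps_const (1 / fact k) * fps_ln 1 ^ k) n"

text \<open>Expectation of a random power series, taken coefficientwise.\<close>
definition fps_expectation :: "'a measure \<Rightarrow> ('a \<Rightarrow> real fps) \<Rightarrow> real fps" where
  "fps_expectation M F = Abs_fps (\<lambda>n. integral\<^sup>L M (\<lambda>\<omega>. F \<omega> $ n))"

definition e_Y :: "'a measure \<Rightarrow> ('a \<Rightarrow> real) \<Rightarrow> real fps" where
  "e_Y M Y = fps_expectation M (\<lambda>\<omega>. fps_exp (Y \<omega>)) - 1"

definition e_Y_deg :: "'a measure \<Rightarrow> ('a \<Rightarrow> real) \<Rightarrow> real \<Rightarrow> real fps" where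
  "e_Y_deg M Y lam = fps_expectation M (\<lambda>\<omega>. deg_exp lam (Y \<omega>)) - 1"

text \<open>Below, \<open>fps_inv\<close> is the compositional inverse, which exists when the coefficient of \<open>t\<close>,
  here the expectation of \<open>Y\<close>, is nonzero.\<close>

definition S2_Y :: "'a measure \<Rightarrow> ('a \<Rightarrow> real) \<Rightarrow> nat \<Rightarrow> nat \<Rightarrow> real" where
  "S2_Y M Y n k = egf_nth (fps_const (1 / fact k) * e_Y M Y ^ k) n"

definition S1_Y :: "'a measure \<Rightarrow> ('a \<Rightarrow> real) \<Rightarrow> nat \<Rightarrow> nat \<Rightarrow> real" where
  "S1_Y M Y n k = egf_nth (fps_const (1 / fact k) * fps_inv (e_Y M Y) ^ k) n"

definition S2_Y_deg :: "'a measure \<Rightarrow> ('a \<Rightarrow> real) \<Rightarrow> real \<Rightarrow> nat \<Rightarrow> nat \<Rightarrow> real" where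
  "S2_Y_deg M Y lam n k = egf_nth (fps_const (1 / fact k) * e_Y_deg M Y lam ^ k) n"

definition S1_Y_deg :: "'a measure \<Rightarrow> ('a \<Rightarrow> real) \<Rightarrow> real \<Rightarrow> nat \<Rightarrow> nat \<Rightarrow> real" where
  "S1_Y_deg M Y lam n k = egf_nth (fps_const (1 / fact k) * fps_inv (e_Y_deg M Y lam) ^ k) n"


subsection \<open>Agreement with the classical descriptions\<close>

lemma fps_deriv_divided_power:
  fixes F :: "real fps"
  shows "fps_deriv (fps_const (1 / fact (Suc k)) * F ^ Suc k) =
    fps_const (1 / fact k) * F ^ k * fps_deriv F"
proof -
  have "fps_deriv (F ^ Suc k) = fps_const (real (Suc k)) * (F ^ k * fps_deriv F)"
    by (subst fps_deriv_power) (simp add: mult_ac)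
  moreover have "1 / fact (Suc k) * real (Suc k) = 1 / fact k"
    by (simp add: divide_simps)
  then have "fps_const (1 / fact (Suc k)) * fps_const (real (Suc k)) = fps_const (1 / fact k)"
    by (simp only: fps_const_mult)
  ultimately show ?thesis
    by (simp only: fps_deriv_mult_const_left mult.assoc[symmetric])
qed

lemma S1_eq_stirling: "S1 n k = (-1) ^ (n + k) * real (stirling n k)"
proof -
  define G :: "nat \<Rightarrow> real fps" where "G k = fps_const (1 / fact k) * fps_ln 1 ^ k" for k
  have d: "fps_deriv (G (Suc k)) * (1 + fps_X) = G k" for k
  proof -
    have u: "inverse (1 + fps_X) * (1 + fps_X) = (1 :: real fps)"
      by (rule inverse_mult_eq_1) simp
    have "fps_deriv (G (Suc k)) = G k * inverse (1 + fps_X)"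
      unfolding G_def fps_deriv_divided_power by (simp add: fps_ln_deriv)
    then show ?thesis using u by (simp add: mult.assoc)
  qed
  have z: "G (Suc k) $ 0 = 0" for k by (simp add: G_def fps_ln_def)
  have r: "real (Suc n) * G (Suc k) $ Suc n = G k $ n - real n * G (Suc k) $ n" for n k
  proof -
    have "(fps_deriv (G (Suc k)) * (1 + fps_X)) $ n = G k $ n" by (simp only: d)
    then show ?thesis by (cases n) (simp_all add: distrib_left algebra_simps)
  qed
  have "egf_nth (G k) n = (-1) ^ (n + k) * real (stirling n k)"
  proof (induction n k rule: stirling.induct)
    case (4 n k)
    have "egf_nth (G (Suc k)) (Suc n) = fact n * (real (Suc n) * G (Suc k) $ Suc n)"
      by (simp add: egf_nth_def)
    also have "\<dots> = egf_nth (G k) n - real n * egf_nth (G (Suc k)) n"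
      by (simp only: r) (simp add: egf_nth_def algebra_simps)
    finally show ?case by (simp add: 4 algebra_simps)
  qed (simp_all add: egf_nth_def G_def z[unfolded G_def] del: fact_Suc power_Suc)
  then show ?thesis by (simp add: S1_def G_def)
qed

lemma Stirling_egf: "real (Stirling n k) = egf_nth (fps_const (1 / fact k) * (fps_exp 1 - 1) ^ k) n"
proof -
  define G :: "nat \<Rightarrow> real fps" where "G k = fps_const (1 / fact k) * (fps_exp 1 - 1) ^ k" for k
  have d: "fps_deriv (G (Suc k)) = G k + of_nat (Suc k) * G (Suc k)" for k
  proof -
    have "fps_deriv (G (Suc k)) = G k * fps_exp 1"
      unfolding G_def fps_deriv_divided_power by simp
    also have "\<dots> = G k + G k * (fps_exp 1 - 1)" by (simp add: algebra_simps)
    also have "G k * (fps_exp 1 - 1) = of_nat (Suc k) * G (Suc k)"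
    proof -
      have "real (Suc k) * (1 / fact (Suc k)) = 1 / fact k" by (simp add: divide_simps)
      then have "of_nat (Suc k) * fps_const (1 / fact (Suc k)) = fps_const (1 / fact k :: real)"
        by (simp only: fps_of_nat[symmetric] fps_const_mult)
      then have "of_nat (Suc k) * G (Suc k) = fps_const (1 / fact k) * (fps_exp 1 - 1) ^ Suc k"
        by (simp only: G_def mult.assoc[symmetric])
      then show ?thesis by (simp add: G_def mult_ac)
    qed
    finally show ?thesis .
  qed
  have z: "G (Suc k) $ 0 = 0" for k by (simp add: G_def)
  have r: "real (Suc n) * G (Suc k) $ Suc n = G k $ n + real (Suc k) * G (Suc k) $ n" for n k
  proof -
    have "fps_deriv (G (Suc k)) $ n = (G k + of_nat (Suc k) * G (Suc k)) $ n" by (simp only: d)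
    then show ?thesis by (simp add: fps_of_nat[symmetric] del: of_nat_Suc)
  qed
  have "egf_nth (G k) n = real (Stirling n k)"
  proof (induction n k rule: Stirling.induct)
    case (4 n k)
    have "egf_nth (G (Suc k)) (Suc n) = fact n * (real (Suc n) * G (Suc k) $ Suc n)"
      by (simp add: egf_nth_def)
    also have "\<dots> = egf_nth (G k) n + real (Suc k) * egf_nth (G (Suc k)) n"
      by (simp only: r) (simp add: egf_nth_def algebra_simps)
    finally show ?case by (simp add: 4 algebra_simps)
  qed (simp_all add: egf_nth_def G_def z[unfolded G_def] del: fact_Suc power_Suc)
  then show ?thesis by (simp add: G_def)
qed

lemma deg_falling_eq_gbinomial:
  assumes "lam \<noteq> 0"
  shows "deg_falling lam x n / fact n = lam ^ n * ((x / lam) gchoose n)"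
proof -
  have "deg_falling lam x n = (\<Prod>i<n. lam * (x / lam - real i))"
    unfolding deg_falling_def using assms by (intro prod.cong) (auto simp: field_simps)
  also have "\<dots> = lam ^ n * (\<Prod>i<n. x / lam - real i)" by (simp add: prod.distrib)
  finally show ?thesis by (simp add: gbinomial_prod_rev atLeast0LessThan)
qed

lemma deg_exp_sums:
  assumes "lam \<noteq> 0" "\<bar>lam * t\<bar> < 1"
  shows "(\<lambda>n. deg_exp lam x $ n * t ^ n) sums ((1 + lam * t) powr (x / lam))"
  using gen_binomial_real[OF assms(2), of "x / lam"]
  by (simp add: deg_exp_def deg_falling_eq_gbinomial[OF assms(1)] power_mult_distrib mult_ac)

lemma e_Y_nth:
  assumes "prob_space M"
  shows "e_Y M Y $ n = (if n = 0 then 0 else integral\<^sup>L M (\<lambda>\<omega>. Y \<omega> ^ n) / fact n)"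
  using prob_space.prob_space[OF assms] by (simp add: e_Y_def fps_expectation_def)

lemma e_Y_deg_nth:
  assumes "prob_space M"
  shows "e_Y_deg M Y lam $ n =
    (if n = 0 then 0 else integral\<^sup>L M (\<lambda>\<omega>. deg_falling lam (Y \<omega>) n) / fact n)"
  using prob_space.prob_space[OF assms]
  by (simp add: e_Y_deg_def fps_expectation_def deg_exp_def deg_falling_def)

lemma integral_sums_dominated:
  fixes f :: "nat \<Rightarrow> 'a \<Rightarrow> real"
  assumes "\<And>n. f n \<in> borel_measurable M" "s \<in> borel_measurable M" "integrable M w"
    and s: "\<And>x. (\<lambda>n. f n x) sums s x"
    and w: "\<And>x. (\<lambda>n. \<bar>f n x\<bar>) sums w x"
  shows "(\<lambda>n. integral\<^sup>L M (f n)) sums integral\<^sup>L M s"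
proof -
  have b: "(\<Sum>i\<in>A. \<bar>f i x\<bar>) \<le> w x" if "finite A" for A x
    using sum_le_suminf[OF sums_summable[OF w[of x]] that] sums_unique[OF w[of x]] by simp
  have i: "integrable M (f n)" for n
    by (rule Bochner_Integration.integrable_bound[OF assms(3)])
      (use assms(1) b[of "{n}"] in \<open>auto intro!: AE_I2 order_trans[OF _ abs_ge_self]\<close>)
  have "(\<lambda>n. integral\<^sup>L M (\<lambda>x. \<Sum>i<n. f i x)) \<longlonglongrightarrow> integral\<^sup>L M s"
  proof (rule integral_dominated_convergence[where w = w])
    show "AE x in M. (\<lambda>n. \<Sum>i<n. f i x) \<longlonglongrightarrow> s x" using s by (simp add: sums_def)
    show "AE x in M. norm (\<Sum>i<n. f i x) \<le> w x" for n
      by (rule AE_I2) (use order_trans[OF sum_abs b] in auto)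
  qed (use assms in auto)
  then show ?thesis using i by (simp add: sums_def)
qed

lemma integrable_exp_abs:
  fixes Y :: "'a \<Rightarrow> real"
  assumes Y[measurable]: "Y \<in> borel_measurable M"
    and "integrable M (\<lambda>\<omega>. exp (Y \<omega> * t))" "integrable M (\<lambda>\<omega>. exp (Y \<omega> * (- t)))"
  shows "integrable M (\<lambda>\<omega>. exp \<bar>Y \<omega> * t\<bar>)"
proof (rule Bochner_Integration.integrable_bound[OF Bochner_Integration.integrable_add[OF assms(2,3)]])
  have "exp \<bar>x\<bar> \<le> \<bar>exp x + exp (- x)\<bar>" for x :: real
    using exp_gt_zero[of x] exp_gt_zero[of "- x"] by (cases "x < 0") linarith+
  then show "AE \<omega> in M. norm (exp \<bar>Y \<omega> * t\<bar>) \<le> norm (exp (Y \<omega> * t) + exp (Y \<omega> * (- t)))"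
    by simp
qed simp

text \<open>The formal series \<open>e_Y\<close> and \<open>e_Y_deg\<close> are the expansions at 0 of the functions they stand
  for, whenever the moment generating function of \<open>Y\<close> exists near 0.\<close>

lemma e_Y_sums:
  fixes Y :: "'a \<Rightarrow> real"
  assumes "prob_space M" and Y[measurable]: "Y \<in> borel_measurable M"
    and "\<And>t. \<bar>t\<bar> < d \<Longrightarrow> integrable M (\<lambda>\<omega>. exp (Y \<omega> * t))" and "\<bar>t\<bar> < d"
  shows "(\<lambda>n. e_Y M Y $ n * t ^ n) sums (integral\<^sup>L M (\<lambda>\<omega>. exp (Y \<omega> * t)) - 1)"
proof -
  have e: "(\<lambda>n. z ^ n / fact n) sums exp z" for z :: real
    using exp_converges[of z] by (simp add: field_simps)
  have "(\<lambda>n. integral\<^sup>L M (\<lambda>\<omega>. (Y \<omega> * t) ^ n / fact n)) sums integral\<^sup>L M (\<lambda>\<omega>. exp (Y \<omega> * t))"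
  proof (rule integral_sums_dominated[where w = "\<lambda>\<omega>. exp \<bar>Y \<omega> * t\<bar>"])
    show "integrable M (\<lambda>\<omega>. exp \<bar>Y \<omega> * t\<bar>)"
      by (rule integrable_exp_abs) (use assms(3)[of t] assms(3)[of "-t"] assms(4) in auto)
    show "(\<lambda>n. \<bar>(Y \<omega> * t) ^ n / fact n\<bar>) sums exp \<bar>Y \<omega> * t\<bar>" for \<omega>
      using e[of "\<bar>Y \<omega> * t\<bar>"] by (simp add: power_abs)
  qed (use e in auto)
  then have "(\<lambda>n. integral\<^sup>L M (\<lambda>\<omega>. (Y \<omega> * t) ^ n / fact n) - (if n = 0 then 1 else 0))
      sums (integral\<^sup>L M (\<lambda>\<omega>. exp (Y \<omega> * t)) - 1)"
    by (rule sums_diff) (use sums_single[of 0 "\<lambda>_. 1 :: real"] in simp)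
  also have "(\<lambda>n. integral\<^sup>L M (\<lambda>\<omega>. (Y \<omega> * t) ^ n / fact n) - (if n = 0 then 1 else 0))
      = (\<lambda>n. e_Y M Y $ n * t ^ n)"
    using prob_space.prob_space[OF assms(1)]
    by (auto simp: e_Y_nth[OF assms(1)] power_mult_distrib fun_eq_iff)
  finally show ?thesis .
qed

lemma e_Y_deg_sums:
  fixes Y :: "'a \<Rightarrow> real"
  assumes "prob_space M" and Y[measurable]: "Y \<in> borel_measurable M" and "d > 0"
    and mgf: "\<And>t. \<bar>t\<bar> < d \<Longrightarrow> integrable M (\<lambda>\<omega>. exp (Y \<omega> * t))" and lam: "lam \<noteq> 0"
  shows "\<forall>\<^sub>F t in nhds 0. (\<lambda>n. e_Y_deg M Y lam $ n * t ^ n)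
    sums (integral\<^sup>L M (\<lambda>\<omega>. (1 + lam * t) powr (Y \<omega> / lam)) - 1)"
proof -
  have "((\<lambda>t. - ln (1 - \<bar>lam * t\<bar>) / \<bar>lam\<bar>) \<longlongrightarrow> - ln (1 - \<bar>lam * 0\<bar>) / \<bar>lam\<bar>) (nhds 0)"
    by (intro tendsto_intros filterlim_ident) (use lam in auto)
  then have "\<forall>\<^sub>F t in nhds 0. - ln (1 - \<bar>lam * t\<bar>) / \<bar>lam\<bar> < d"
    using \<open>d > 0\<close> by (auto dest: order_tendstoD(2))
  moreover have "((\<lambda>t. \<bar>lam * t\<bar>) \<longlongrightarrow> \<bar>lam * 0\<bar>) (nhds 0)"
    by (intro tendsto_intros filterlim_ident)
  then have "\<forall>\<^sub>F t in nhds 0. \<bar>lam * t\<bar> < 1" by (rule order_tendstoD(2)) auto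
  ultimately show ?thesis
  proof eventually_elim
    case (elim t)
    define c where "c = - ln (1 - \<bar>lam * t\<bar>) / \<bar>lam\<bar>"
    have c: "0 \<le> c" "c < d" using elim by (auto simp: c_def divide_nonpos_nonneg)
    define g where "g n y = deg_falling lam y n / fact n * t ^ n" for n y
    have g: "g n y = ((y / lam) gchoose n) * (lam * t) ^ n" for n y
      by (simp add: g_def deg_falling_eq_gbinomial[OF lam] power_mult_distrib)
    define h where "h n y = ((- \<bar>y / lam\<bar>) gchoose n) * (- \<bar>lam * t\<bar>) ^ n" for n y
    have h_eq: "h n y = pochhammer \<bar>y / lam\<bar> n / fact n * \<bar>lam * t\<bar> ^ n" for n y
    proof -
      have "h n y = ((-1) ^ n * (-1) ^ n) * (pochhammer \<bar>y / lam\<bar> n / fact n * \<bar>lam * t\<bar> ^ n)"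
        by (simp add: h_def gbinomial_pochhammer power_minus[of "\<bar>lam * t\<bar>"])
      then show ?thesis by (simp add: power_mult_distrib[symmetric])
    qed
    have gh: "\<bar>g n y\<bar> \<le> h n y" for n y
    proof -
      have "\<bar>\<Prod>i<n. y / lam - real i\<bar> \<le> (\<Prod>i<n. \<bar>y / lam\<bar> + real i)"
        unfolding abs_prod by (intro prod_mono) (auto simp del: abs_divide)
      then have "\<bar>(y / lam) gchoose n\<bar> \<le> pochhammer \<bar>y / lam\<bar> n / fact n"
        by (simp add: gbinomial_prod_rev pochhammer_prod atLeast0LessThan divide_right_mono)
      then show ?thesis unfolding g h_eq abs_mult power_abs by (intro mult_right_mono) auto
    qed
    have hs: "(\<lambda>n. h n y) sums exp (c * \<bar>y\<bar>)" for y
    proof -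
      have "(\<lambda>n. h n y) sums (1 + - \<bar>lam * t\<bar>) powr (- \<bar>y / lam\<bar>)"
        unfolding h_def by (rule gen_binomial_real) (use elim in auto)
      also have "(1 + - \<bar>lam * t\<bar>) powr (- \<bar>y / lam\<bar>) = exp (c * \<bar>y\<bar>)"
        using elim by (simp add: powr_def c_def abs_divide)
      finally show ?thesis .
    qed
    have int: "integrable M (\<lambda>\<omega>. exp (c * \<bar>Y \<omega>\<bar>))"
    proof -
      have "integrable M (\<lambda>\<omega>. exp \<bar>Y \<omega> * c\<bar>)"
        by (rule integrable_exp_abs) (use mgf[of c] mgf[of "-c"] c in auto)
      then show ?thesis using c by (simp add: abs_mult mult.commute)
    qed
    have m[measurable]: "(\<lambda>\<omega>. g n (Y \<omega>)) \<in> borel_measurable M" for n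
      unfolding g_def deg_falling_def by measurable
    have gs: "summable (\<lambda>n. \<bar>g n y\<bar>)" for y
      by (rule summable_comparison_test[OF _ sums_summable[OF hs[of y]]]) (use gh in auto)
    have "(\<lambda>n. integral\<^sup>L M (\<lambda>\<omega>. g n (Y \<omega>)))
        sums integral\<^sup>L M (\<lambda>\<omega>. (1 + lam * t) powr (Y \<omega> / lam))"
    proof (rule integral_sums_dominated[where w = "\<lambda>\<omega>. \<Sum>n. \<bar>g n (Y \<omega>)\<bar>"])
      show "integrable M (\<lambda>\<omega>. \<Sum>n. \<bar>g n (Y \<omega>)\<bar>)"
      proof (rule Bochner_Integration.integrable_bound[OF int])
        show "AE \<omega> in M. norm (\<Sum>n. \<bar>g n (Y \<omega>)\<bar>) \<le> norm (exp (c * \<bar>Y \<omega>\<bar>))"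
        proof (rule AE_I2)
          fix \<omega>
          have "(\<Sum>n. \<bar>g n (Y \<omega>)\<bar>) \<le> exp (c * \<bar>Y \<omega>\<bar>)"
            using suminf_le[OF gh gs sums_summable[OF hs]] sums_unique[OF hs] by metis
          then show "norm (\<Sum>n. \<bar>g n (Y \<omega>)\<bar>) \<le> norm (exp (c * \<bar>Y \<omega>\<bar>))"
            using suminf_nonneg[OF gs] by simp
        qed
      qed measurable
      show "(\<lambda>n. g n (Y \<omega>)) sums ((1 + lam * t) powr (Y \<omega> / lam))" for \<omega>
        unfolding g by (rule gen_binomial_real) (use elim in auto)
      show "(\<lambda>n. \<bar>g n (Y \<omega>)\<bar>) sums (\<Sum>n. \<bar>g n (Y \<omega>)\<bar>)" for \<omega>
        by (rule summable_sums[OF gs])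
    qed measurable
    then have "(\<lambda>n. integral\<^sup>L M (\<lambda>\<omega>. g n (Y \<omega>)) - (if n = 0 then 1 else 0))
        sums (integral\<^sup>L M (\<lambda>\<omega>. (1 + lam * t) powr (Y \<omega> / lam)) - 1)"
      by (rule sums_diff) (use sums_single[of 0 "\<lambda>_. 1 :: real"] in simp)
    also have "(\<lambda>n. integral\<^sup>L M (\<lambda>\<omega>. g n (Y \<omega>)) - (if n = 0 then 1 else 0))
        = (\<lambda>n. e_Y_deg M Y lam $ n * t ^ n)"
      using prob_space.prob_space[OF assms(1)]
      by (auto simp: e_Y_deg_nth[OF assms(1)] g_def fun_eq_iff deg_falling_def)
    finally show ?case .
  qed
qed

end

theory Submission
  imports Defs
begin

text \<open>
  For a normal \<open>Y\<close>, completing the square gives the moment generating function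
  \<open>exp (P t)\<close> with the quadratic \<open>P t = \<mu> t + (\<sigma>\<^sup>2 / 2) t\<^sup>2\<close>, so that \<open>e_Y = (exp - 1) \<circ> P\<close> as power
  series (\<open>e_Y_normal\<close>). Everything else is composition of power series.

  The degenerate series reduces to the ordinary one: \<open>(1 + lam t) powr (y / lam) = exp (y W)\<close> for
  \<open>W = ln (1 + lam t) / lam\<close>, hence \<open>e_Y_deg = e_Y \<circ> W\<close> for every \<open>Y\<close> with finite moments
  (\<open>e_Y_deg_eq_compose\<close>). As the powers of \<open>W\<close> generate the Stirling numbers of the first kind,
  \<open>S2_Y_deg\<close> is a transform of \<open>S2_Y\<close>. The inverse of \<open>W\<close> is \<open>(exp (lam s) - 1) / lam\<close>, whose powers
  generate the Stirling numbers of the second kind, so \<open>S1_Y_deg\<close> is likewise a transform of \<open>S1_Y\<close>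
  (\<open>S2_Y_deg_eq_sum\<close>, \<open>S1_Y_deg_eq_sum\<close>).

  It remains to compute powers. For \<open>S2_Y\<close>, the powers of \<open>P\<close> are given by the binomial theorem.
  For \<open>S1_Y\<close>, inverting \<open>e_Y\<close> means solving the quadratic equation \<open>P s = ln (1 + t)\<close>, whose root
  vanishing at \<open>0\<close> is \<open>(\<mu> / \<sigma>\<^sup>2) (sqrt (1 + 2 (\<sigma> / \<mu>)\<^sup>2 ln (1 + t)) - 1)\<close> (\<open>fps_inv_e_Y_normal\<close>). Its
  \<open>j\<close>-th power is expanded by the binomial theorem and the binomial series; this explains the
  half-integers \<open>j / 2\<close> in the formulas.

  In the last formula the series over \<open>j\<close> is a finite sum in disguise. Its inner sum over \<open>l\<close> is,
  up to a factor, the coefficient of \<open>x ^ m\<close> in \<open>(sqrt (1 + x) - 1) ^ j\<close>, and this power series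
  starts with \<open>x ^ j\<close>. So the terms with \<open>j > m\<close> vanish, and there is no question of convergence
  or of the order of summation.
\<close>

section \<open>Formal power series\<close>

text \<open>The equation determines the coefficients one after another from the constant term.\<close>

lemma fps_ODE_unique:
  fixes F G Q :: "'a :: field_char_0 fps"
  assumes F: "fps_deriv F = Q * F" and G: "fps_deriv G = Q * G" and "F $ 0 = G $ 0"
  shows "F = G"
proof -
  define D where "D = F - G"
  have D: "fps_deriv D = Q * D" and D0: "D $ 0 = 0"
    using assms by (simp_all add: D_def algebra_simps)
  have "D $ n = 0" for n
  proof (induction n rule: less_induct)
    case (less n)
    show ?case
    proof (cases n)
      case (Suc m)
      have "of_nat (Suc m) * D $ Suc m = (Q * D) $ m"
        by (simp add: D[symmetric] del: of_nat_Suc)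
      also have "\<dots> = 0"
        unfolding fps_mult_nth using less Suc by (intro sum.neutral) auto
      finally show ?thesis using Suc by (simp del: of_nat_Suc)
    qed (use D0 in simp)
  qed
  then show ?thesis by (simp add: D_def fps_eq_iff)
qed

text \<open>It suffices that an expansion of the zero function is zero. Its constant coefficient is the
  value at \<open>0\<close>, and its formal derivative is again an expansion of the zero function.\<close>

lemma has_fps_expansion_unique:
  fixes f :: "'a :: {banach, real_normed_field} \<Rightarrow> 'a"
  assumes "f has_fps_expansion F" "f has_fps_expansion G"
  shows "F = G"
proof -
  have zero: "D $ n = 0" if "(\<lambda>_. 0 :: 'a) has_fps_expansion D" for D n
    using that
  proof (induction n arbitrary: D)
    case 0
    then have "eval_fps D 0 = 0"
      by (auto simp: has_fps_expansion_def dest: eventually_nhds_x_imp_x)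
    then show ?case by (simp add: eval_fps_at_0)
  next
    case (Suc n)
    from has_fps_expansion_deriv[OF Suc.prems]
    have "(\<lambda>_. 0 :: 'a) has_fps_expansion fps_deriv D" by simp
    then have "fps_deriv D $ n = 0" by (rule Suc.IH)
    then show ?case by (simp del: of_nat_Suc)
  qed
  have "(\<lambda>_. 0) has_fps_expansion (F - G)"
    using has_fps_expansion_diff[OF assms] by simp
  from zero[OF this] show ?thesis by (simp add: fps_eq_iff)
qed

lemma fps_inv_eqI:
  fixes F G :: "'a :: field fps"
  assumes "F $ 0 = 0" "F $ 1 \<noteq> 0" "G $ 0 = 0" "F oo G = fps_X"
  shows "fps_inv F = G"
proof -
  have "G = (fps_inv F oo F) oo G"
    using assms by (simp add: fps_inv)
  also have "\<dots> = fps_inv F oo (F oo G)"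
    by (rule fps_compose_assoc[symmetric]) (use assms in auto)
  finally show ?thesis using assms by simp
qed

lemma fps_exp_ln_inverse:
  "(fps_exp 1 - 1) oo fps_ln 1 = (fps_X :: real fps)"
  "fps_ln 1 oo (fps_exp 1 - 1) = (fps_X :: real fps)"
  using fps_inv_fps_exp_compose[of "1 :: real"] by (simp_all add: fps_ln_fps_exp_inv)

text \<open>Both sides satisfy the differential equation of the binomial series.\<close>

lemma fps_binomial_eq_exp_ln: "fps_binomial c = fps_exp c oo (fps_ln 1 :: real fps)"
proof -
  have "fps_deriv (fps_exp c oo (fps_ln 1 :: real fps)) =
      fps_const c * (fps_exp c oo fps_ln 1) / (1 + fps_X)"
    by (simp add: fps_compose_deriv fps_ln_deriv fps_const_mult_apply_left[symmetric] fps_divide_unit)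
  then have "fps_exp c oo fps_ln 1 = (fps_binomial c :: real fps)"
    by (intro iffD1[OF fps_binomial_ODE_unique']) simp
  then show ?thesis ..
qed

lemma fps_ln_power_nth: "(fps_ln 1 ^ m) $ n = fact m / fact n * S1 n m"
  by (simp add: S1_def egf_nth_def)

lemma fps_exp_minus_one_power_nth:
  "((fps_exp 1 - 1) ^ k) $ j = fact k / fact j * real (Stirling j k)"
  by (simp add: Stirling_egf egf_nth_def)

lemma falling_eq_gbinomial: "falling x m = fact m * (x gchoose m)"
  by (simp add: falling_def gbinomial_prod_rev atLeast0LessThan)

text \<open>Factor out \<open>fps_X ^ j\<close>; what is left is the power of a linear polynomial. The exponent
  \<open>j - (n - j)\<close> of \<open>a\<close> is the integer \<open>2 * j - n\<close> only when \<open>n - j \<le> j\<close>, and otherwise the binomial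
  coefficient is \<open>0\<close>.\<close>

lemma quadratic_power_nth:
  fixes a c :: real
  shows "((fps_const a * fps_X + fps_const c * fps_X\<^sup>2) ^ j) $ n =
    (if j \<le> n then real (j choose (n - j)) * a powi (2 * int j - int n) * c ^ (n - j) else 0)"
proof -
  have "fps_const a * fps_X + fps_const c * fps_X\<^sup>2 = fps_X * (fps_const c * fps_X + fps_const a)"
    by (simp add: power2_eq_square algebra_simps)
  then have factor: "(fps_const a * fps_X + fps_const c * fps_X\<^sup>2) ^ j =
      fps_X ^ j * (fps_const c * fps_X + fps_const a) ^ j"
    by (simp only: power_mult_distrib)
  have linear: "((fps_const c * fps_X + fps_const a) ^ j) $ i =
      real (j choose i) * c ^ i * a ^ (j - i)" for i
  proof -
    have "((fps_const c * fps_X + fps_const a) ^ j) $ i =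
        (\<Sum>l\<le>j. if l = i then real (j choose i) * c ^ i * a ^ (j - i) else 0)"
      unfolding binomial_ring fps_sum_nth
      by (intro sum.cong refl)
        (auto simp: power_mult_distrib fps_of_nat[symmetric] mult_ac)
    also have "\<dots> = real (j choose i) * c ^ i * a ^ (j - i)"
      by (auto simp: binomial_eq_0)
    finally show ?thesis .
  qed
  have "real (j choose (n - j)) * a ^ (j - (n - j)) =
      real (j choose (n - j)) * a powi (2 * int j - int n)" if "j \<le> n"
  proof (cases "n - j \<le> j")
    case True
    then have "2 * int j - int n = int (j - (n - j))" using that by simp
    then show ?thesis by (simp only: power_int_of_nat)
  qed (simp add: binomial_eq_0)
  then show ?thesis
    unfolding factor fps_X_power_mult_nth linear by (auto simp: mult_ac)
qed

section \<open>The degenerate series of a random variable\<close>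

text \<open>The power series of \<open>ln (1 + lam * t) / lam\<close>.\<close>

definition deg_ln :: "real \<Rightarrow> real fps" where
  "deg_ln lam = fps_const (1 / lam) * (fps_ln 1 oo (fps_const lam * fps_X))"

lemma deg_ln_0 [simp]: "deg_ln lam $ 0 = 0"
  by (simp add: deg_ln_def)

lemma deg_ln_1 [simp]: "lam \<noteq> 0 \<Longrightarrow> deg_ln lam $ Suc 0 = 1"
  by (simp add: deg_ln_def fps_ln_nth)

lemma deg_ln_power_nth:
  assumes "lam \<noteq> 0" "m \<le> n"
  shows "(deg_ln lam ^ m) $ n = fact m / fact n * lam ^ (n - m) * S1 n m"
proof -
  have "deg_ln lam ^ m = fps_const ((1 / lam) ^ m) * (fps_ln 1 ^ m oo (fps_const lam * fps_X))"
    by (simp add: deg_ln_def power_mult_distrib fps_compose_power fps_const_power)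
  then have "(deg_ln lam ^ m) $ n = (1 / lam) ^ m * (lam ^ n * (fact m / fact n * S1 n m))"
    by (simp add: fps_ln_power_nth)
  then show ?thesis
    using assms by (simp add: power_diff power_one_over field_simps)
qed

lemma deg_exp_eq_exp_deg_ln:
  assumes "lam \<noteq> 0"
  shows "deg_exp lam y = fps_exp y oo deg_ln lam"
proof -
  have "fps_exp y oo deg_ln lam = (fps_exp y oo (fps_const (1 / lam) * fps_X)) oo
      (fps_ln 1 oo (fps_const lam * fps_X))"
    by (subst fps_compose_assoc[symmetric]) (simp_all add: deg_ln_def fps_const_mult_apply_left[symmetric])
  also have "\<dots> = fps_binomial (y / lam) oo (fps_const lam * fps_X)"
    by (simp add: fps_compose_assoc fps_binomial_eq_exp_ln)
  also have "\<dots> = deg_exp lam y"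
    using assms by (simp add: fps_eq_iff deg_exp_def deg_falling_eq_gbinomial)
  finally show ?thesis ..
qed

text \<open>\<open>\<bar>y\<bar> ^ n / fact n\<close> is a single term of the exponential series of \<open>\<bar>y\<bar>\<close>.\<close>

lemma integrable_power_of_mgf:
  fixes Y :: "'a \<Rightarrow> real"
  assumes [measurable]: "Y \<in> borel_measurable M"
    and mgf: "\<And>t. integrable M (\<lambda>\<omega>. exp (Y \<omega> * t))"
  shows "integrable M (\<lambda>\<omega>. Y \<omega> ^ n)"
proof (rule Bochner_Integration.integrable_bound)
  show "integrable M (\<lambda>\<omega>. fact n * exp \<bar>Y \<omega> * 1\<bar>)"
    by (intro integrable_mult_right integrable_exp_abs mgf) simp
  have "\<bar>y\<bar> ^ n \<le> fact n * exp \<bar>y\<bar>" for y :: real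
  proof -
    have e: "(\<lambda>n. \<bar>y\<bar> ^ n / fact n) sums exp \<bar>y\<bar>"
      using exp_converges[of "\<bar>y\<bar>"] by (simp add: field_simps)
    have "\<bar>y\<bar> ^ n / fact n \<le> exp \<bar>y\<bar>"
      using sum_le_suminf[OF sums_summable[OF e], of "{n}"] sums_unique[OF e] by simp
    then show ?thesis by (simp add: field_simps)
  qed
  then show "AE \<omega> in M. norm (Y \<omega> ^ n) \<le> norm (fact n * exp \<bar>Y \<omega> * 1\<bar>)"
    by (simp add: power_abs)
qed measurable

text \<open>Each coefficient of a composition is a finite linear combination of coefficients of the outer
  series, so the expectation passes through \<open>oo deg_ln lam\<close> by linearity, given finite moments.\<close>

lemma e_Y_deg_eq_compose:
  fixes Y :: "'a \<Rightarrow> real"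
  assumes "lam \<noteq> 0" and moments: "\<And>n. integrable M (\<lambda>\<omega>. Y \<omega> ^ n)"
  shows "e_Y_deg M Y lam = e_Y M Y oo deg_ln lam"
proof -
  have "fps_expectation M (\<lambda>\<omega>. deg_exp lam (Y \<omega>)) =
      fps_expectation M (\<lambda>\<omega>. fps_exp (Y \<omega>)) oo deg_ln lam"
    using moments
    by (simp add: fps_eq_iff fps_expectation_def deg_exp_eq_exp_deg_ln[OF assms(1)]
        fps_compose_nth)
  then show ?thesis
    by (simp add: e_Y_deg_def e_Y_def fps_compose_sub_distrib)
qed

text \<open>Expand \<open>(e_Y \<circ> deg_ln) ^ k = e_Y ^ k \<circ> deg_ln\<close> in powers of \<open>deg_ln\<close>. The sum starts at \<open>k\<close>
  because \<open>e_Y\<close> has no constant term.\<close>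

lemma S2_Y_deg_eq_sum:
  fixes Y :: "'a \<Rightarrow> real"
  assumes "lam \<noteq> 0" and "prob_space M" and "\<And>n. integrable M (\<lambda>\<omega>. Y \<omega> ^ n)"
  shows "S2_Y_deg M Y lam n k = (\<Sum>m=k..n. S2_Y M Y m k * lam ^ (n - m) * S1 n m)"
proof -
  have "S2_Y_deg M Y lam n k = fact n / fact k * (\<Sum>m=0..n. (e_Y M Y ^ k) $ m * (deg_ln lam ^ m) $ n)"
    using assms by (simp add: S2_Y_deg_def egf_nth_def e_Y_deg_eq_compose fps_compose_power fps_compose_nth)
  also have "\<dots> = (\<Sum>m=0..n. S2_Y M Y m k * lam ^ (n - m) * S1 n m)"
    unfolding sum_distrib_left
    using assms by (intro sum.cong refl) (simp add: S2_Y_def egf_nth_def deg_ln_power_nth)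
  also have "\<dots> = (\<Sum>m=k..n. S2_Y M Y m k * lam ^ (n - m) * S1 n m)"
    using startsby_zero_power_prefix[of "e_Y M Y" k] e_Y_nth[OF assms(2), of Y 0]
    by (intro sum.mono_neutral_right) (auto simp: S2_Y_def egf_nth_def)
  finally show ?thesis .
qed

text \<open>The inverse of \<open>e_Y \<circ> deg_ln\<close> is the inverse of \<open>deg_ln\<close> after the inverse of \<open>e_Y\<close>.\<close>

lemma fps_inv_e_Y_deg:
  fixes Y :: "'a \<Rightarrow> real"
  assumes lam: "lam \<noteq> 0" and moments: "\<And>n. integrable M (\<lambda>\<omega>. Y \<omega> ^ n)"
    and e: "e_Y M Y $ 0 = 0" "e_Y M Y $ 1 \<noteq> 0"
  shows "fps_inv (e_Y_deg M Y lam) =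
    fps_const (1 / lam) * ((fps_exp 1 - 1) oo (fps_const lam * fps_inv (e_Y M Y)))"
proof (rule fps_inv_eqI)
  define G where "G = fps_inv (e_Y M Y)"
  have G0: "G $ 0 = 0" by (simp add: G_def fps_inv_def)
  have eq: "e_Y_deg M Y lam = e_Y M Y oo deg_ln lam"
    by (rule e_Y_deg_eq_compose[OF lam moments])
  define E where "E = (fps_exp 1 - 1 :: real fps) oo (fps_const lam * G)"
  have E0: "E $ 0 = 0" by (simp add: E_def)
  have "deg_ln lam oo (fps_const (1 / lam) * E) =
      fps_const (1 / lam) * (fps_ln 1 oo ((fps_const lam * fps_X) oo (fps_const (1 / lam) * E)))"
    using E0 by (simp add: deg_ln_def fps_const_mult_apply_left[symmetric] fps_compose_assoc[symmetric])
  also have "(fps_const lam * fps_X) oo (fps_const (1 / lam) * E) =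
      fps_const lam * (fps_const (1 / lam) * E)"
    using E0 by (simp only: fps_const_mult_apply_left[symmetric]) simp
  also have "\<dots> = E"
    using lam by (simp add: mult.assoc[symmetric])
  also have "fps_ln 1 oo E = fps_const lam * G"
    unfolding E_def using G0 by (subst fps_compose_assoc) (simp_all add: fps_exp_ln_inverse)
  also have "fps_const (1 / lam) * (fps_const lam * G) = G"
    using lam by (simp add: mult.assoc[symmetric])
  finally have c: "deg_ln lam oo (fps_const (1 / lam) * E) = G" .
  show "e_Y_deg M Y lam oo (fps_const (1 / lam) * ((fps_exp 1 - 1) oo
      (fps_const lam * fps_inv (e_Y M Y)))) = fps_X"
    unfolding eq G_def[symmetric] E_def[symmetric] using E0 c e
    by (subst fps_compose_assoc[symmetric]) (simp_all add: G_def fps_inv_right)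
  show "e_Y_deg M Y lam $ 0 = 0" "e_Y_deg M Y lam $ 1 \<noteq> 0"
    unfolding eq using e lam by (simp_all add: fps_compose_nth)
qed simp

text \<open>By \<open>fps_inv_e_Y_deg\<close>, \<open>lam\<close> times the inverse of \<open>e_Y_deg\<close> is \<open>exp - 1\<close> at \<open>lam\<close> times the
  inverse of \<open>e_Y\<close>; its \<open>k\<close>-th power is expanded in powers of the latter.\<close>

lemma S1_Y_deg_eq_sum:
  fixes Y :: "'a \<Rightarrow> real"
  assumes "lam \<noteq> 0" and "\<And>n. integrable M (\<lambda>\<omega>. Y \<omega> ^ n)"
    and "e_Y M Y $ 0 = 0" "e_Y M Y $ 1 \<noteq> 0"
  shows "S1_Y_deg M Y lam n k = 1 / lam ^ k * (\<Sum>j=k..n. lam ^ j * real (Stirling j k) * S1_Y M Y n j)"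
proof -
  define G where "G = fps_inv (e_Y M Y)"
  have G0: "G $ 0 = 0" by (simp add: G_def fps_inv_def)
  have "fps_inv (e_Y_deg M Y lam) ^ k = fps_const ((1 / lam) ^ k) *
      ((fps_exp 1 - 1) ^ k oo (fps_const lam * G))"
    by (simp only: fps_inv_e_Y_deg[OF assms] power_mult_distrib fps_const_power G_def[symmetric])
      (simp add: fps_compose_power G0)
  also have "\<dots> $ n = 1 / lam ^ k * (\<Sum>j=0..n. fact k / fact j * real (Stirling j k) *
      (lam ^ j * (G ^ j) $ n))"
    unfolding fps_mult_left_const_nth fps_compose_nth power_mult_distrib[of "fps_const _"]
      fps_const_power fps_exp_minus_one_power_nth by (simp add: power_one_over)
  also have "\<dots> = 1 / lam ^ k * (\<Sum>j=k..n. fact k / fact j * real (Stirling j k) *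
      (lam ^ j * (G ^ j) $ n))"
    by (intro arg_cong[where f = "(*) _"] sum.mono_neutral_right) auto
  finally show ?thesis
    by (simp add: S1_Y_deg_def S1_Y_def egf_nth_def G_def sum_distrib_left mult_ac)
qed

section \<open>The normal distribution\<close>

text \<open>Completing the square: tilting a normal density exponentially shifts its mean.\<close>

lemma normal_density_mult_exp:
  assumes "\<sigma> > 0"
  shows "normal_density \<mu> \<sigma> x * exp (x * t) =
    exp (\<mu> * t + \<sigma>\<^sup>2 / 2 * t\<^sup>2) * normal_density (\<mu> + \<sigma>\<^sup>2 * t) \<sigma> x"
proof -
  have "- (x - \<mu>)\<^sup>2 / (2 * \<sigma>\<^sup>2) + x * t =
      \<mu> * t + \<sigma>\<^sup>2 / 2 * t\<^sup>2 + - (x - (\<mu> + \<sigma>\<^sup>2 * t))\<^sup>2 / (2 * \<sigma>\<^sup>2)"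
    using assms by (simp add: field_simps power2_eq_square)
  then show ?thesis
    by (simp add: normal_density_def mult_exp_exp)
qed

lemma normal_mgf:
  assumes D: "distributed M lborel Y (normal_density \<mu> \<sigma>)" and "\<sigma> > 0"
  shows "integrable M (\<lambda>\<omega>. exp (Y \<omega> * t))"
    and "integral\<^sup>L M (\<lambda>\<omega>. exp (Y \<omega> * t)) = exp (\<mu> * t + \<sigma>\<^sup>2 / 2 * t\<^sup>2)"
proof -
  have "integrable lborel (\<lambda>x. normal_density \<mu> \<sigma> x * exp (x * t))"
    unfolding normal_density_mult_exp[OF assms(2)] using assms(2) by simp
  then show "integrable M (\<lambda>\<omega>. exp (Y \<omega> * t))"
    by (subst (asm) distributed_integrable[OF D]) auto
  show "integral\<^sup>L M (\<lambda>\<omega>. exp (Y \<omega> * t)) = exp (\<mu> * t + \<sigma>\<^sup>2 / 2 * t\<^sup>2)"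
    by (subst distributed_integral[OF D, symmetric])
      (use assms(2) in \<open>auto simp: normal_density_mult_exp\<close>)
qed

text \<open>The moment generating function \<open>m\<close> satisfies \<open>m' = (\<mu> + \<sigma>\<^sup>2 t) m\<close>. By uniqueness of power series
  expansions, so does its formal series \<open>e_Y + 1\<close>, and this linear differential equation with
  constant term \<open>1\<close> has \<open>exp \<circ> P\<close> as its only formal solution.\<close>

lemma e_Y_normal:
  assumes "prob_space M" and D: "distributed M lborel Y (normal_density \<mu> \<sigma>)" and "\<sigma> > 0"
  shows "e_Y M Y = (fps_exp 1 - 1) oo (fps_const \<mu> * fps_X + fps_const (\<sigma>\<^sup>2 / 2) * fps_X\<^sup>2)"
proof -
  define m where "m t = exp (\<mu> * t + \<sigma>\<^sup>2 / 2 * t\<^sup>2)" for t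
  define P where "P = fps_const \<mu> * fps_X + fps_const (\<sigma>\<^sup>2 / 2) * fps_X\<^sup>2"
  define Q where "Q = fps_const \<mu> + fps_const (\<sigma>\<^sup>2) * fps_X"
  define F where "F = e_Y M Y + 1"
  have [measurable]: "Y \<in> borel_measurable M"
    using distributed_measurable[OF D] by simp
  have s: "(\<lambda>n. e_Y M Y $ n * t ^ n) sums (m t - 1)" for t
    using e_Y_sums[of M Y "\<bar>t\<bar> + 1" t] assms normal_mgf[OF D] by (simp add: m_def)
  have "(\<lambda>t. m t - 1) has_fps_expansion e_Y M Y"
    by (rule has_fps_expansionI) (use s in auto)
  then have F: "m has_fps_expansion F"
    unfolding F_def by (auto dest: has_fps_expansion_add[OF _ has_fps_expansion_1])
  have "(m has_real_derivative (\<mu> + \<sigma>\<^sup>2 * t) * m t) (at t)" for t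
    unfolding m_def by (auto intro!: derivative_eq_intros simp: power2_eq_square)
  then have "deriv m = (\<lambda>t. (\<mu> + \<sigma>\<^sup>2 * t) * m t)"
    by (auto intro!: DERIV_imp_deriv)
  with has_fps_expansion_deriv[OF F]
  have "(\<lambda>t. (\<mu> + \<sigma>\<^sup>2 * t) * m t) has_fps_expansion fps_deriv F" by simp
  moreover have "(\<lambda>t. (\<mu> + \<sigma>\<^sup>2 * t) * m t) has_fps_expansion Q * F"
    unfolding Q_def by (intro fps_expansion_intros F)
  ultimately have "fps_deriv F = Q * F"
    by (rule has_fps_expansion_unique)
  moreover have "fps_deriv (fps_exp 1 oo P) = Q * (fps_exp 1 oo P)"
    by (simp add: P_def Q_def fps_compose_deriv fps_deriv_power mult_ac)
  moreover have "F $ 0 = (fps_exp 1 oo P) $ 0"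
    by (simp add: F_def e_Y_nth[OF assms(1)])
  ultimately have "F = fps_exp 1 oo P" by (rule fps_ODE_unique)
  then show ?thesis
    by (simp add: F_def P_def fps_compose_sub_distrib algebra_simps)
qed

lemma S2_Y_normal:
  assumes "prob_space M" and "distributed M lborel Y (normal_density \<mu> \<sigma>)" and "\<sigma> > 0"
  shows "S2_Y M Y n k = (\<Sum>j=k..n. fact n / fact j * real (j choose (n - j))
        * \<mu> powi (2 * int j - int n) * (\<sigma>\<^sup>2 / 2) ^ (n - j) * real (Stirling j k))"
proof -
  have "S2_Y M Y n k = (\<Sum>j=0..n. fact n / fact j * real (j choose (n - j))
        * \<mu> powi (2 * int j - int n) * (\<sigma>\<^sup>2 / 2) ^ (n - j) * real (Stirling j k))"
    unfolding S2_Y_def egf_nth_def e_Y_normal[OF assms] fps_mult_left_const_nth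
    by (subst fps_compose_power)
      (auto simp: fps_compose_nth fps_exp_minus_one_power_nth quadratic_power_nth
        sum_distrib_left intro!: sum.cong)
  also have "\<dots> = (\<Sum>j=k..n. fact n / fact j * real (j choose (n - j))
        * \<mu> powi (2 * int j - int n) * (\<sigma>\<^sup>2 / 2) ^ (n - j) * real (Stirling j k))"
    by (intro sum.mono_neutral_right) auto
  finally show ?thesis .
qed

text \<open>The coefficient of \<open>x ^ m\<close> in \<open>(sqrt (1 + x) - 1) ^ j\<close>. It is also the \<open>j\<close>-th finite difference
  at \<open>0\<close> of \<open>l \<mapsto> (l / 2) gchoose m\<close>, a polynomial of degree \<open>m\<close> in \<open>l\<close>.\<close>

definition sqrt_diff :: "nat \<Rightarrow> nat \<Rightarrow> real" where
  "sqrt_diff j m = ((fps_binomial (1/2) - 1) ^ j) $ m"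

lemma sqrt_diff_eq_0: "m < j \<Longrightarrow> sqrt_diff j m = 0"
  by (simp add: sqrt_diff_def startsby_zero_power_prefix)

lemma fact_mult_sqrt_diff:
  "fact m * sqrt_diff j m = (\<Sum>l=0..j. (- 1) ^ (j + l) * real (j choose l) * falling (real l / 2) m)"
proof -
  have "(fps_binomial (1/2) - 1 :: real fps) ^ j =
      (\<Sum>l\<le>j. of_nat (j choose l) * fps_binomial (real l / 2) * (- 1) ^ (j - l))"
    using binomial_ring[of "fps_binomial (1/2) :: real fps" "- 1" j]
    by (simp add: fps_binomial_power)
  moreover have "(of_nat (j choose l) * fps_binomial (real l / 2) * (- 1) ^ (j - l)) $ m =
      (- 1) ^ (j + l) * real (j choose l) * (real l / 2 gchoose m)" if "l \<le> j" for l
  proof -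
    have "(- 1 :: real fps) ^ (j - l) = fps_const ((- 1) ^ (j + l))"
      using that by (simp add: minus_one_power_iff)
    then show ?thesis
      by (simp only: fps_of_nat[symmetric] fps_mult_right_const_nth fps_mult_left_const_nth
          fps_binomial_nth mult_ac)
  qed
  ultimately show ?thesis
    by (auto simp: sqrt_diff_def fps_sum_nth falling_eq_gbinomial sum_distrib_left
        atLeast0AtMost intro!: sum.cong)
qed

text \<open>Composing \<open>e_Y = (exp - 1) \<circ> P\<close> with the claimed inverse \<open>G\<close> gives \<open>t\<close> as soon as
  \<open>P \<circ> G = ln (1 + t)\<close>, that is, as soon as \<open>G\<close> is a root of a quadratic equation over power series.
  The root with constant term \<open>0\<close> is the one with \<open>sqrt - 1\<close>.\<close>

lemma fps_inv_e_Y_normal: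
  assumes "prob_space M" and "distributed M lborel Y (normal_density \<mu> \<sigma>)" and "\<sigma> > 0"
    and "\<mu> \<noteq> 0"
  shows "fps_inv (e_Y M Y) = fps_const (\<mu> / \<sigma>\<^sup>2) *
    ((fps_binomial (1/2) - 1) oo (fps_const (2 * (\<sigma> / \<mu>)\<^sup>2) * fps_ln 1))"
proof (rule fps_inv_eqI)
  define P where "P = fps_const \<mu> * fps_X + fps_const (\<sigma>\<^sup>2 / 2) * fps_X\<^sup>2"
  have e: "e_Y M Y = (fps_exp 1 - 1) oo P"
    unfolding P_def by (rule e_Y_normal[OF assms(1-3)])
  define a where "a = \<mu> / \<sigma>\<^sup>2"
  define L where "L = fps_const (2 * (\<sigma> / \<mu>)\<^sup>2) * (fps_ln 1 :: real fps)"
  have L0: "L $ 0 = 0" by (simp add: L_def)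
  define R where "R = fps_binomial (1/2) oo L"
  have R2: "R * R = 1 + L"
  proof -
    have "R * R = (fps_binomial (1/2) * fps_binomial (1/2)) oo L"
      by (simp add: R_def fps_compose_mult_distrib[OF L0])
    also have "fps_binomial (1/2) * fps_binomial (1/2) = (1 + fps_X :: real fps)"
      by (simp add: fps_binomial_add_mult[symmetric] fps_binomial_1)
    finally show ?thesis using L0 by (simp add: fps_compose_add_distrib)
  qed
  have G: "fps_const a * ((fps_binomial (1/2) - 1) oo L) = fps_const a * (R - 1)"
    by (simp add: R_def fps_compose_sub_distrib)
  have "P oo (fps_const a * (R - 1)) = fps_ln 1"
  proof -
    have "P oo (fps_const a * (R - 1)) = fps_const (\<mu> * a) * (R - 1) +
        fps_const (\<sigma>\<^sup>2 / 2 * a\<^sup>2) * (R - 1)\<^sup>2"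
      by (simp add: P_def fps_compose_add_distrib fps_const_mult_apply_left[symmetric] fps_compose_power[symmetric]
          R_def power_mult_distrib fps_const_power mult.assoc[symmetric])
    \<comment> \<open>\<open>P\<close> with its square completed: the terms linear in \<open>R\<close> cancel.\<close>
    also have "\<mu> * a = \<mu>\<^sup>2 / (2 * \<sigma>\<^sup>2) * 2" by (simp add: a_def power2_eq_square)
    also have "\<sigma>\<^sup>2 / 2 * a\<^sup>2 = \<mu>\<^sup>2 / (2 * \<sigma>\<^sup>2)"
      using assms by (simp add: a_def power2_eq_square)
    also have "fps_const (\<mu>\<^sup>2 / (2 * \<sigma>\<^sup>2) * 2) * (R - 1) + fps_const (\<mu>\<^sup>2 / (2 * \<sigma>\<^sup>2)) * (R - 1)\<^sup>2 =
        fps_const (\<mu>\<^sup>2 / (2 * \<sigma>\<^sup>2)) * (R * R - 1)"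
    proof -
      have "fps_const (q * 2) * (R - 1) + fps_const q * (R - 1)\<^sup>2 = fps_const q * (R * R - 1)" for q
      proof -
        have "fps_const (q * 2) = fps_const q * 2" by (simp add: numeral_fps_const)
        then show ?thesis by (simp only: power2_eq_square) (simp add: algebra_simps)
      qed
      then show ?thesis .
    qed
    also have "\<dots> = fps_const (\<mu>\<^sup>2 / (2 * \<sigma>\<^sup>2) * (2 * (\<sigma> / \<mu>)\<^sup>2)) * fps_ln 1"
      by (simp add: R2 L_def mult.assoc[symmetric])
    also have "\<mu>\<^sup>2 / (2 * \<sigma>\<^sup>2) * (2 * (\<sigma> / \<mu>)\<^sup>2) = 1"
      using assms by (simp add: power2_eq_square)
    finally show ?thesis by simp
  qed
  then have "e_Y M Y oo (fps_const a * ((fps_binomial (1/2) - 1) oo L)) = fps_X"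
    unfolding e G
    by (subst fps_compose_assoc[symmetric]) (simp_all add: R_def P_def fps_exp_ln_inverse)
  then show "e_Y M Y oo (fps_const (\<mu> / \<sigma>\<^sup>2) * ((fps_binomial (1/2) - 1) oo
      (fps_const (2 * (\<sigma> / \<mu>)\<^sup>2) * fps_ln 1))) = fps_X"
    by (simp add: a_def L_def)
  show "e_Y M Y $ 0 = 0" "e_Y M Y $ 1 \<noteq> 0"
    using assms(4) by (simp_all add: e P_def fps_compose_nth)
qed simp

lemma fps_inv_e_Y_normal_power_nth:
  assumes "prob_space M" and "distributed M lborel Y (normal_density \<mu> \<sigma>)" and "\<sigma> > 0"
    and "\<mu> \<noteq> 0"
  shows "(fps_inv (e_Y M Y) ^ j) $ n = (\<mu> / \<sigma>\<^sup>2) ^ j / fact n *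
    (\<Sum>m=0..n. fact m * sqrt_diff j m * 2 ^ m * (\<sigma> / \<mu>) ^ (2 * m) * S1 n m)"
proof -
  have scale: "(2 * (\<sigma> / \<mu>)\<^sup>2) ^ m = 2 ^ m * (\<sigma> / \<mu>) ^ (2 * m)" for m
    by (simp only: power_mult_distrib power_mult)
  have "fps_inv (e_Y M Y) ^ j = fps_const ((\<mu> / \<sigma>\<^sup>2) ^ j) *
      ((fps_binomial (1/2) - 1) ^ j oo (fps_const (2 * (\<sigma> / \<mu>)\<^sup>2) * fps_ln 1))"
    by (simp only: fps_inv_e_Y_normal[OF assms] power_mult_distrib fps_const_power)
      (simp add: fps_compose_power)
  also have "\<dots> $ n = (\<mu> / \<sigma>\<^sup>2) ^ j * (\<Sum>m=0..n. sqrt_diff j m *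
      ((2 * (\<sigma> / \<mu>)\<^sup>2) ^ m * (fact m / fact n * S1 n m)))"
    unfolding fps_mult_left_const_nth fps_compose_nth power_mult_distrib[of "fps_const _"]
      fps_const_power fps_ln_power_nth sqrt_diff_def ..
  also have "\<dots> = (\<mu> / \<sigma>\<^sup>2) ^ j / fact n *
    (\<Sum>m=0..n. fact m * sqrt_diff j m * 2 ^ m * (\<sigma> / \<mu>) ^ (2 * m) * S1 n m)"
    by (simp only: sum_distrib_left scale) (simp add: mult_ac)
  finally show ?thesis .
qed

lemma S1_Y_normal:
  assumes "prob_space M" and "distributed M lborel Y (normal_density \<mu> \<sigma>)" and "\<sigma> > 0"
    and "\<mu> \<noteq> 0"
  shows "S1_Y M Y n k = 1 / fact k * (- (\<mu> / \<sigma>\<^sup>2)) ^ k *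
      (\<Sum>j=0..k. \<Sum>l=0..n. (- 1) ^ j * real (k choose j) * falling (real j / 2) l
        * 2 ^ l * (\<sigma> / \<mu>) ^ (2 * l) * S1 n l)"
proof -
  have "S1_Y M Y n k = 1 / fact k * (\<mu> / \<sigma>\<^sup>2) ^ k *
      (\<Sum>l=0..n. fact l * sqrt_diff k l * 2 ^ l * (\<sigma> / \<mu>) ^ (2 * l) * S1 n l)"
    by (simp add: S1_Y_def egf_nth_def fps_inv_e_Y_normal_power_nth[OF assms])
  also have "\<dots> = 1 / fact k * (\<mu> / \<sigma>\<^sup>2) ^ k * ((- 1) ^ k *
      (\<Sum>l=0..n. \<Sum>j=0..k. (- 1) ^ j * real (k choose j) * falling (real j / 2) l
        * 2 ^ l * (\<sigma> / \<mu>) ^ (2 * l) * S1 n l))"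
    unfolding fact_mult_sqrt_diff
    by (simp add: sum_distrib_left sum_distrib_right power_add mult_ac)
  also have "\<dots> = 1 / fact k * (- (\<mu> / \<sigma>\<^sup>2)) ^ k *
      (\<Sum>l=0..n. \<Sum>j=0..k. (- 1) ^ j * real (k choose j) * falling (real j / 2) l
        * 2 ^ l * (\<sigma> / \<mu>) ^ (2 * l) * S1 n l)"
    by (simp only: power_minus[of "\<mu> / \<sigma>\<^sup>2"] mult_ac)
  finally show ?thesis
    by (subst sum.swap)
qed

theorem theorem2p7:
  fixes M :: "'a measure" and Y :: "'a \<Rightarrow> real" and lam \<mu> \<sigma> :: real and n k :: nat
  assumes "prob_space M"
    and "distributed M lborel Y (normal_density \<mu> \<sigma>)"
    and "\<mu> \<noteq> 0" and "\<sigma> > 0" and "lam \<noteq> 0" and "k \<le> n"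
  shows "S2_Y M Y n k =
      (\<Sum>j=k..n. fact n / fact j * real (j choose (n - j)) * \<mu> powi (2 * int j - int n)
        * (\<sigma>\<^sup>2 / 2) ^ (n - j) * real (Stirling j k))
    \<and> S1_Y M Y n k =
      1 / fact k * (- (\<mu> / \<sigma>\<^sup>2)) ^ k *
      (\<Sum>j=0..k. \<Sum>l=0..n. (- 1) ^ j * real (k choose j) * falling (real j / 2) l
        * 2 ^ l * (\<sigma> / \<mu>) ^ (2 * l) * S1 n l)
    \<and> S2_Y_deg M Y lam n k =
      (\<Sum>m=k..n. \<Sum>j=k..m. fact m / fact j * real (j choose (m - j))
        * \<mu> powi (2 * int j - int m) * (\<sigma>\<^sup>2 / 2) ^ (m - j) * lam ^ (n - m)
        * real (Stirling j k) * S1 n m)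
    \<and> (let T = (\<lambda>m j. \<Sum>l=0..j. (- 1) ^ (j + l) * (1 / fact j) * (lam * \<mu> / \<sigma>\<^sup>2) ^ j
            * falling (real l / 2) m * 2 ^ m * (\<sigma> / \<mu>) ^ (2 * m)
            * real (j choose l) * real (Stirling j k) * S1 n m)
      in (\<forall>m\<le>n. summable (\<lambda>i. T m (k + i))) \<and>
         S1_Y_deg M Y lam n k = 1 / lam ^ k * (\<Sum>m=0..n. \<Sum>i. T m (k + i)))"
proof -
  note normal = assms(1,2,4)
  have [measurable]: "Y \<in> borel_measurable M"
    using distributed_measurable[OF assms(2)] by simp
  have moments: "integrable M (\<lambda>\<omega>. Y \<omega> ^ i)" for i
    by (rule integrable_power_of_mgf) (use normal_mgf(1)[OF assms(2,4)] in auto)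
  have e: "e_Y M Y $ 0 = 0" "e_Y M Y $ 1 \<noteq> 0"
    using assms(3) by (simp_all add: e_Y_normal[OF normal] fps_compose_nth)

  have S2_deg: "S2_Y_deg M Y lam n k =
      (\<Sum>m=k..n. \<Sum>j=k..m. fact m / fact j * real (j choose (m - j))
        * \<mu> powi (2 * int j - int m) * (\<sigma>\<^sup>2 / 2) ^ (m - j) * lam ^ (n - m)
        * real (Stirling j k) * S1 n m)"
    unfolding S2_Y_deg_eq_sum[OF assms(5,1) moments] S2_Y_normal[OF normal] sum_distrib_right
    by (simp add: mult_ac)

  define T where "T m j = (\<Sum>l=0..j. (- 1) ^ (j + l) * (1 / fact j) * (lam * \<mu> / \<sigma>\<^sup>2) ^ j
            * falling (real l / 2) m * 2 ^ m * (\<sigma> / \<mu>) ^ (2 * m)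
            * real (j choose l) * real (Stirling j k) * S1 n m)" for m j
  have T: "T m j = (1 / fact j) * (lam * \<mu> / \<sigma>\<^sup>2) ^ j * real (Stirling j k)
      * (fact m * sqrt_diff j m * 2 ^ m * (\<sigma> / \<mu>) ^ (2 * m) * S1 n m)" for m j
    unfolding T_def fact_mult_sqrt_diff by (simp add: sum_distrib_left sum_distrib_right mult_ac)
  \<comment> \<open>Here the index \<open>k + i\<close> exceeds \<open>n\<close>, hence \<open>m\<close>.\<close>
  have T0: "T m (k + i) = 0" if "m \<le> n" "i \<notin> {0..n - k}" for m i
    unfolding T using that assms(6) by (simp add: sqrt_diff_eq_0)
  have summable: "summable (\<lambda>i. T m (k + i))" if "m \<le> n" for m
    by (rule summable_finite[of "{0..n - k}"]) (use T0[OF that] in auto)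
  have suminf: "(\<Sum>i. T m (k + i)) = (\<Sum>j=k..n. T m j)" if "m \<le> n" for m
  proof -
    have "(\<Sum>i. T m (k + i)) = (\<Sum>i=0..n - k. T m (k + i))"
      by (rule suminf_finite) (use T0[OF that] in auto)
    also have "\<dots> = (\<Sum>j=k..n. T m j)"
      using assms(6) sum.shift_bounds_cl_nat_ivl[of "T m" 0 k "n - k"] by (simp add: add.commute)
    finally show ?thesis .
  qed
  have "S1_Y_deg M Y lam n k = 1 / lam ^ k * (\<Sum>j=k..n. \<Sum>m=0..n. T m j)"
    unfolding S1_Y_deg_eq_sum[OF assms(5) moments e] T
    by (simp add: S1_Y_def egf_nth_def fps_inv_e_Y_normal_power_nth[OF normal assms(3)]
        power_mult_distrib power_divide sum_distrib_left mult_ac)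
  also have "\<dots> = 1 / lam ^ k * (\<Sum>m=0..n. \<Sum>i. T m (k + i))"
    by (subst sum.swap) (simp add: suminf)
  finally show ?thesis
    using S2_Y_normal[OF normal] S1_Y_normal[OF normal assms(3)] S2_deg summable
    by (simp add: Let_def T_def)
qed

end
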